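(* Let $n$ be a positive integer coprime with $6$, and let $M$ be either $n-1$ or $(n-1)/2$. Then \[ \sum_{k=0}^{M}[8k+1] \frac{(q;q^2)_k^2\, (q;q^2)_{2k}\, (q^{-3};q^6)_k} {(q^2;q^2)_{2k}\,(q^6;q^6)_k\, (q^{-3},q^6;q^2)_{k} }\, q^{2k} \equiv 0 \pmod{[n]^2}. \]
   Context: Here $q$ is an indeterminate. For $x$ and a base $p$ (a power of $q$), $(x;p)_k=\prod_{j=0}^{k-1}(1-xp^j)$ and $(x_1,x_2;p)_k=(x_1;p)_k(x_2;p)_k$. The $q$-integer is $[j]=1+q+\cdots+q^{j-1}$. For rational functions $A(q),B(q)$ and a polynomial $P(q)$, $A\equiv B\pmod{P}$ means that the numerator of the reduced form of $A-B$ is divisible by $P$ in $\mathbb{Z}[q]$. *)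

theory Defs
  imports "HOL-Computational_Algebra.Polynomial_Factorial"
begin

text \<open>Rational functions in \<open>q\<close> are the elements of \<^typ>\<open>int poly fract\<close>, the fraction field
  of \<open>\<int>[q]\<close>; this is the field \<open>\<rat>(q)\<close>. The indeterminate occurs in two types, as a
  polynomial (for the modulus) and as a rational function (for the summands).\<close>

definition qpoly :: "int poly"
  where "qpoly = [:0, 1:]"

definition qrat :: "int poly fract"
  where "qrat = to_fract qpoly"

definition q_int :: "'a::comm_semiring_1 \<Rightarrow> nat \<Rightarrow> 'a"
  where "q_int q n = (\<Sum>i<n. q ^ i)"

text \<open>\<open>q_poch x p k\<close> is the shifted factorial \<open>(x; p)\<^sub>k\<close>.\<close>

definition q_poch :: "'a::comm_ring_1 \<Rightarrow> 'a \<Rightarrow> nat \<Rightarrow> 'a"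
  where "q_poch x p k = (\<Prod>j<k. 1 - x * p ^ j)"

text \<open>\<^const>\<open>quot_of_fract\<close> yields numerator and denominator of the reduced form over \<open>\<int>[q]\<close>,
  coprime there and with the leading coefficient of the denominator positive.\<close>

definition q_cong :: "int poly fract \<Rightarrow> int poly fract \<Rightarrow> int poly \<Rightarrow> bool"
  where "q_cong A B P \<longleftrightarrow> P dvd fst (quot_of_fract (A - B))"

end

theory Submission
  imports Defs
begin

text \<open>The sum telescopes:
  \[
  \sum_{k=0}^{M} = \frac{(q;q^2)_{M+1}\,(q;q^2)_{2M+2}\,(q^3;q^6)_M}
    {(1-q)^2(1-q^3)\,(q^2;q^2)_{2M}\,(q^6;q^6)_M\,(q^6;q^2)_M}.
  \]
  Integrality of the central \<open>q\<close>-binomial coefficients makes \<open>(x;x\<^sup>2)\<^sub>k / (x\<^sup>2;x\<^sup>2)\<^sub>k\<close> a polynomial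
  over \<open>(-x;x)\<^sub>k\<^sup>2\<close>. Pairing odd and even factorials of equal length in this way leaves
  two factors divisible by \<open>[n]\<close> in the numerator: \<open>1 - q\<^bsup>4n\<^esup>\<close> and \<open>1 - q\<^bsup>6n\<^esup>\<close> if \<open>M = n - 1\<close>,
  and \<open>1 - q\<^sup>n\<close> and \<open>1 - q\<^bsup>2n\<^esup>\<close> if \<open>M = (n - 1)/2\<close>. What remains in the denominator are factors
  \<open>1 + q\<^sup>i\<close>, and \<open>1 - q\<^sup>i\<close> with \<open>i\<close> coprime to \<open>n\<close>, all of them coprime to \<open>[n]\<close>.\<close>

section \<open>Shifted factorials and \<open>q\<close>-integers\<close>

lemma q_poch_0 [simp]: "q_poch x p 0 = 1"
  by (simp add: q_poch_def)

lemma q_poch_Suc: "q_poch x p (Suc k) = q_poch x p k * (1 - x * p ^ k)"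
  by (simp add: q_poch_def)

lemma q_poch_add: "q_poch x p (m + k) = q_poch x p m * q_poch (x * p ^ m) p k"
  by (induction k) (simp_all add: q_poch_Suc power_add mult.assoc)

lemma q_int_mult: "(1 - q) * q_int q n = 1 - q ^ n" for q :: "'a::comm_ring_1"
  by (simp add: q_int_def one_diff_power_eq)

subsection \<open>The sum in closed form\<close>

text \<open>Telescoping step with \<open>y = q^(2*M)\<close>, common factors removed: the left side
  collects the new factors of \<open>sum_num\<close>, the first product on the right those of
  \<open>sum_den\<close>, and the subtracted product, with its sign, is the summand of index
  \<open>M + 1\<close>.\<close>

lemma step_identity:
  fixes q y :: "'a::comm_ring_1"
  shows "(1 - q^3*y) * (1 - q^5*y^2) * (1 - q^7*y^2) * (1 - q^3*y^3)
     = (1 - q^2*y^2) * (1 - q^4*y^2) * (1 - q^6*y^3) * (1 - q^6*y)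
       - (1 - q^3) * (q^2*y) * (q - y) * (1 - q*y) * (1 - q^9*y^4)"
  by (simp add: algebra_simps eval_nat_numeral)

text \<open>Both equations eliminate the base \<open>q powi (-3)\<close>. For the second,
  \<open>(q^-3; q^2)_k\<close> starts and ends two factors before \<open>(q; q^2)_k\<close>;
  multiplying both sides by \<open>q^4\<close> clears the negative powers from the four differing
  factors.\<close>

lemma q_poch_powi_neg3:
  fixes q :: "'a::field"
  assumes "q \<noteq> 0"
  shows "q_poch (q powi (-3)) (q^6) (Suc k) = (1 - q powi (-3)) * q_poch (q^3) (q^6) k"
    and "q_poch (q powi (-3)) (q^2) k * ((q^3 - q^(2*k)) * (q - q^(2*k)))
           = (q^3 - 1) * (q - 1) * q_poch q (q^2) k"
proof -
  have "q powi (-3) * q^6 = q^3"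
    using assms by (simp add: power_int_minus field_simps flip: power_add)
  then show "q_poch (q powi (-3)) (q^6) (Suc k) = (1 - q powi (-3)) * q_poch (q^3) (q^6) k"
    using q_poch_add[of "q powi (-3)" "q^6" 1 k] by (simp add: q_poch_Suc)
  show "q_poch (q powi (-3)) (q^2) k * ((q^3 - q^(2*k)) * (q - q^(2*k)))
           = (q^3 - 1) * (q - 1) * q_poch q (q^2) k"
  proof (induction k)
    case (Suc k)
    define y where "y = q ^ (2 * k)"
    have y: "(q^2)^k = y" "q ^ (2 * Suc k) = q^2 * y"
      by (simp_all add: y_def power_mult power2_eq_square)
    have f: "(1 - q powi (-3) * y) * (q^3 - q^2*y) * (q - q^2*y)
       = (q^3 - y) * (q - y) * (1 - q * y)"
      using assms by (simp add: power_int_minus field_simps) algebra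
    have "q_poch (q powi (-3)) (q^2) (Suc k) * ((q^3 - q^2*y) * (q - q^2*y))
       = q_poch (q powi (-3)) (q^2) k * ((1 - q powi (-3) * y) * (q^3 - q^2*y) * (q - q^2*y))"
      by (simp add: q_poch_Suc y mult_ac)
    also have "\<dots> = (q_poch (q powi (-3)) (q^2) k * ((q^3 - y) * (q - y))) * (1 - q * y)"
      unfolding f by (simp only: mult_ac)
    also have "\<dots> = (q^3 - 1) * (q - 1) * q_poch q (q^2) (Suc k)"
      using Suc.IH by (simp add: q_poch_Suc y flip: y_def)
    finally show ?case by (simp only: y)
  qed simp
qed

text \<open>Numerator and denominator of the closed form are kept apart and over any commutative
  ring, so that they serve both in \<open>int poly\<close>, for divisibility, and in its fraction
  field, for the sum.\<close>

definition sum_num :: "'a::comm_ring_1 \<Rightarrow> nat \<Rightarrow> 'a" where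
  "sum_num q M = q_poch q (q^2) (M + 1) * q_poch q (q^2) (2 * M + 2) * q_poch (q^3) (q^6) M"

definition sum_den :: "'a::comm_ring_1 \<Rightarrow> nat \<Rightarrow> 'a" where
  "sum_den q M = (1 - q)^2 * (1 - q^3) * q_poch (q^2) (q^2) (2 * M) * q_poch (q^6) (q^6) M
      * q_poch (q^6) (q^2) M"

lemma q_poch_nonzero:
  fixes q :: "'a::idom"
  assumes "\<And>i. i > 0 \<Longrightarrow> q ^ i \<noteq> 1" and "a > 0"
  shows "q_poch (q ^ a) (q ^ b) k \<noteq> 0"
  using assms(1)[of "a + b * _"] assms(2)
  by (auto simp: q_poch_def simp flip: power_mult power_add)

lemma sum_den_nonzero:
  fixes q :: "'a::idom"
  assumes "\<And>i. i > 0 \<Longrightarrow> q ^ i \<noteq> 1"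
  shows "sum_den q M \<noteq> 0"
  using assms[of 1] assms[of 3] q_poch_nonzero[OF assms]
  by (simp add: sum_den_def)

lemma sum_closed_form:
  fixes q :: "'a::field"
  assumes q0: "q \<noteq> 0" and q1: "\<And>i. i > 0 \<Longrightarrow> q ^ i \<noteq> 1"
  shows "(\<Sum>k=0..M. q_int q (8 * k + 1) *
       ((q_poch q (q ^ 2) k) ^ 2 * q_poch q (q ^ 2) (2 * k) * q_poch (q powi (-3)) (q ^ 6) k /
        (q_poch (q ^ 2) (q ^ 2) (2 * k) * q_poch (q ^ 6) (q ^ 6) k *
          (q_poch (q powi (-3)) (q ^ 2) k * q_poch (q ^ 6) (q ^ 2) k))) * q ^ (2 * k))
     = sum_num q M / sum_den q M" (is "(\<Sum>k=0..M. ?t k) = _")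
proof (induction M)
  case 0
  have "1 - q \<noteq> 0" "1 - q^3 \<noteq> 0"
    using q1[of 1] q1[of 3] by auto
  then show ?case
    by (simp add: sum_num_def sum_den_def q_int_def q_poch_Suc numeral_2_eq_2 power3_eq_cube)
next
  case (Suc M)
  define y where "y = q ^ (2 * M)"
  have y: "(q^2)^M = y" "(q^2)^(2*M) = y^2" "(q^6)^M = y^3" "q ^ (2 * Suc M) = q^2*y"
    "q ^ (8 * Suc M + 1) = q^9*y^4"
    by (simp_all add: y_def mult_ac flip: power_mult power_add)
  define A B C where "A = q_poch q (q^2) (Suc M)" and "B = q_poch q (q^2) (2 * M + 2)"
    and "C = q_poch (q^3) (q^6) M"
  define E F G where "E = q_poch (q^2) (q^2) (2 * M)" and "F = q_poch (q^6) (q^6) M"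
    and "G = q_poch (q^6) (q^2) M"
  define H where "H = q_poch (q powi (-3)) (q^2) (Suc M)"
  define e1 e2 f g where "e1 = 1 - q^2*y^2" and "e2 = 1 - q^4*y^2" and "f = 1 - q^6*y^3"
    and "g = 1 - q^6*y"
  define c where "c = (1 - q)^2 * (1 - q^3)"
  note defs = A_def B_def C_def E_def F_def G_def H_def e1_def e2_def f_def g_def c_def
  have E': "q_poch (q^2) (q^2) (2 * Suc M) = E * e1 * e2"
    and F': "q_poch (q^6) (q^6) (Suc M) = F * f"
    and G': "q_poch (q^6) (q^2) (Suc M) = G * g"
    and A': "q_poch q (q^2) (Suc M + 1) = A * (1 - q^3*y)"
    and B': "q_poch q (q^2) (2 * Suc M + 2) = B * (1 - q^5*y^2) * (1 - q^7*y^2)"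
    and C': "q_poch (q^3) (q^6) (Suc M) = C * (1 - q^3*y^3)"
    by (simp_all add: defs q_poch_Suc y)
      (simp_all add: eval_nat_numeral mult_ac)
  have nz: "1 - q \<noteq> 0" "1 - q^3 \<noteq> 0" "A \<noteq> 0"
    using q1[of 1] q1[of 3] q_poch_nonzero[OF q1, of 1 2] by (auto simp: A_def)
  have "c * E * F * G \<noteq> 0" and "E * e1 * e2 \<noteq> 0" and "F * f \<noteq> 0" and "G * g \<noteq> 0"
    using sum_den_nonzero[OF q1, of M] q_poch_nonzero[OF q1]
    unfolding E'[symmetric] F'[symmetric] G'[symmetric]
    by (simp_all add: sum_den_def c_def E_def F_def G_def)
  then have nz': "c \<noteq> 0" "E \<noteq> 0" "F \<noteq> 0" "G \<noteq> 0" "e1 \<noteq> 0" "e2 \<noteq> 0" "f \<noteq> 0" "g \<noteq> 0"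
    by auto
  \<comment> \<open>Here \<open>q^(2*k)\<close> is \<open>q^2*y\<close>, so \<open>q^2\<close> and
    \<open>q\<close> come out of the two factors, which explains \<open>q^3\<close>.\<close>
  have H: "H * (q^3 * ((q - y) * (1 - q*y))) = (1 - q^3) * (1 - q) * A"
    using q_poch_powi_neg3(2)[OF q0, of "Suc M"]
    unfolding y H_def[symmetric] A_def[symmetric]
    by (simp add: eval_nat_numeral algebra_simps)
  have "H \<noteq> 0"
    using H nz by auto
  \<comment> \<open>One of the two copies of \<open>A\<close> in the summand cancels against
    \<open>H\<close> up to this quotient; this is the source of \<open>(q - y) * (1 - q*y)\<close>
    in \<open>step_identity\<close>.\<close>
  have AH: "A / H = q^3 * ((q - y) * (1 - q*y)) / ((1 - q^3) * (1 - q))"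
    using H \<open>H \<noteq> 0\<close> nz by (simp add: frac_eq_eq mult_ac)
  have t: "?t (Suc M) = (1 - q^9*y^4) / (1 - q) *
      ((A / H) * (A * B * ((1 - q powi (-3)) * C)) / (E * e1 * e2 * (F * f * (G * g)))) * (q^2 * y)"
  proof -
    have "q_int q (8 * Suc M + 1) = (1 - q^9*y^4) / (1 - q)"
      using q_int_mult[of q "8 * Suc M + 1"] nz unfolding y by (simp add: field_simps)
    moreover have "q_poch q (q^2) (2 * Suc M) = B"
      by (simp add: B_def)
    ultimately show ?thesis
      by (simp only: E' F' G' q_poch_powi_neg3(1)[OF q0] y flip: A_def C_def H_def)
        (simp add: power2_eq_square mult_ac)
  qed
  have r: "1 - q powi (-3) = - (1 - q^3) / q^3"
    using q0 by (simp add: power_int_minus field_simps)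
  \<comment> \<open>The powers \<open>q^3\<close> from \<open>AH\<close> and \<open>r\<close>
    cancel. The factor \<open>1 - q^3\<close> balances the one in \<open>c\<close>, so that all
    three fractions below share a denominator.\<close>
  define u where "u = (1 - q^3) * (q^2*y) * (q - y) * (1 - q*y) * (1 - q^9*y^4)"
  have "?t (Suc M) = - (A * B * C * u)
      / (c * (E * e1 * e2) * (F * f) * (G * g))"
  proof -
    obtain d where d: "1 - q^3 = d"
      by blast
    show ?thesis
      unfolding t AH r c_def u_def d using q0 nz(1) nz(2)[unfolded d] nz'
      by (simp add: divide_simps) (simp add: power2_eq_square mult_ac)
  qed
  moreover have "sum_num q M / sum_den q M
      = A * B * C * (e1 * e2 * f * g) / (c * (E * e1 * e2) * (F * f) * (G * g))"
  proof -
    have "q_poch q (q^2) (Suc (Suc (2 * M))) = B"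
      by (simp add: B_def)
    then show ?thesis
      using nz' by (simp add: sum_num_def sum_den_def divide_simps flip: defs)
  qed
  moreover have "sum_num q (Suc M) / sum_den q (Suc M)
      = A * B * C * (e1 * e2 * f * g - u) / (c * (E * e1 * e2) * (F * f) * (G * g))"
  proof -
    have "sum_num q (Suc M)
        = A * B * C * ((1 - q^3*y) * (1 - q^5*y^2) * (1 - q^7*y^2) * (1 - q^3*y^3))"
      unfolding sum_num_def A' B' C' by (simp only: mult_ac)
    then show ?thesis
      unfolding step_identity sum_den_def E' F' G' c_def u_def e1_def e2_def f_def g_def by simp
  qed
  ultimately show ?case
    by (simp only: sum.atLeast0_atMost_Suc Suc.IH)
      (simp only: right_diff_distrib diff_divide_distrib add_uminus_conv_diff
        flip: minus_divide_left)
qed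

subsection \<open>Divisibility by the square of the \<open>q\<close>-integer\<close>

text \<open>The \<open>q\<close>-Pascal rule, from
  \<open>1 - x^(m+k) = (1 - x^m) + x^m * (1 - x^k)\<close>, by induction on
  \<open>m + k\<close>.\<close>

lemma q_poch_mult_dvd: "q_poch x x m * q_poch x x k dvd q_poch x x (m + k)"
proof (induction "m + k" arbitrary: m k)
  case (Suc s)
  show ?case
  proof (cases m; cases k)
    fix a b assume ab: "m = Suc a" "k = Suc b"
    have "q_poch x x a * q_poch x x k * (1 - x ^ m) dvd q_poch x x (a + k) * (1 - x ^ m)"
      and "q_poch x x m * q_poch x x b * (x ^ m * (1 - x ^ k)) dvd q_poch x x (m + b) * (x ^ m * (1 - x ^ k))"
      using Suc.hyps(1)[of a k] Suc.hyps(1)[of m b] Suc.hyps(2) ab by (auto intro: mult_dvd_mono)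
    moreover have "q_poch x x (m + k) = q_poch x x (a + k) * (1 - x ^ m)
        + q_poch x x (m + b) * (x ^ m * (1 - x ^ k))"
      by (simp add: ab q_poch_Suc algebra_simps power_add)
    ultimately show ?thesis
      by (auto simp: ab q_poch_Suc intro!: dvd_add elim!: dvd_trans[rotated])
        (auto simp: mult_ac)
  qed auto
qed simp

text \<open>The quotient is the central \<open>q\<close>-binomial coefficient
  \<open>(x;x)_{2k} / (x;x)_k^2\<close>, rewritten with \<open>double\<close> and
  \<open>even\<close>.\<close>

lemma central_q_binomial_dvd:
  fixes x :: "'a::idom"
  assumes "q_poch (x^2) (x^2) k \<noteq> 0"
  shows "q_poch (x^2) (x^2) k dvd q_poch x (x^2) k * q_poch (- x) x k ^ 2"
proof -
  have double: "q_poch x x (2 * k) = q_poch x (x^2) k * q_poch (x^2) (x^2) k"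
    by (induction k) (simp_all add: q_poch_Suc power_mult mult_ac power2_eq_square power_mult_distrib)
  have even: "q_poch (x^2) (x^2) k = q_poch x x k * q_poch (- x) x k"
    by (induction k) (simp_all add: q_poch_Suc algebra_simps power2_eq_square power_mult_distrib)
  have "q_poch x x k * q_poch x x k * q_poch (- x) x k ^ 2
      dvd q_poch x (x^2) k * q_poch (x^2) (x^2) k * q_poch (- x) x k ^ 2"
    using q_poch_mult_dvd[of x k k] by (simp add: mult_dvd_mono flip: double mult_2)
  then have "q_poch (x^2) (x^2) k * q_poch (x^2) (x^2) k
      dvd q_poch (x^2) (x^2) k * (q_poch x (x^2) k * q_poch (- x) x k ^ 2)"
    unfolding even by (simp only: power2_eq_square mult_ac)
  then show ?thesis
    using assms by simp
qed

section \<open>Coprimality with \<open>[n]\<close> over the integers\<close>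

text \<open>A divisor of a nonzero constant is constant, and the constant coefficient
  \<open>1\<close> of \<open>[n]\<close> makes it a unit. This excludes common integer factors,
  which matter in \<open>int poly\<close>.\<close>

lemma q_int_unit_divisor:
  fixes c :: "int poly"
  assumes "c dvd q_int qpoly n" and "c dvd [:k:]" and "n > 0" and "k \<noteq> 0"
  shows "is_unit c"
proof -
  have "degree c \<le> degree [:k:]"
    using assms by (intro dvd_imp_degree_le) auto
  then obtain m where m: "c = [:m:]"
    by (metis degree_eq_zeroE degree_pCons_0 le_zero_eq)
  have "coeff (q_int qpoly n) 0 = 1"
    using \<open>n > 0\<close> by (simp add: q_int_def qpoly_def coeff_sum coeff_0_power sum.delta if_distrib power_0_left)
  then have "m dvd 1"
    using assms(1) by (metis const_poly_dvd_iff m)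
  then show ?thesis
    by (simp add: m is_unit_const_poly_iff)
qed

text \<open>A common divisor divides \<open>1 - q^n\<close> and \<open>1 - q^i\<close>, hence
  \<open>1 - q\<close> by Bezout. Since \<open>[n]\<close> is congruent to \<open>n\<close> modulo
  \<open>1 - q\<close>, it divides the constant \<open>n\<close>.\<close>

lemma coprime_q_int_one_minus:
  assumes "coprime i n" and "n > 0"
  shows "coprime (q_int qpoly n) (1 - qpoly ^ i)"
proof (rule coprimeI)
  fix c assume c: "c dvd q_int qpoly n" "c dvd 1 - qpoly ^ i"
  have dvd_n: "c dvd 1 - qpoly ^ n"
    using c(1) by (metis q_int_mult dvd_mult)
  have cong: "c dvd 1 - (qpoly ^ m) ^ k" if "c dvd 1 - qpoly ^ m" for m k
    using that by (metis q_int_mult dvd_mult2)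
  have "c dvd 1 - qpoly"
  \<comment> \<open>For \<open>i = 0\<close> coprimality forces \<open>n = 1\<close>, so
    \<open>dvd_n\<close> is already the claim.\<close>
  proof (cases "i = 0")
    case True
    then show ?thesis
      using assms dvd_n by simp
  next
    case False
    then obtain a b where ab: "i * a = n * b + 1"
      using assms(1) bezout_nat[of i n] by auto
    have "c dvd (1 - (qpoly ^ i) ^ a) - qpoly * (1 - (qpoly ^ n) ^ b)"
      by (intro dvd_diff dvd_mult cong c dvd_n)
    also have "\<dots> = 1 - qpoly"
    proof -
      have "(qpoly ^ i) ^ a = qpoly * (qpoly ^ n) ^ b"
        by (simp add: ab flip: power_mult power_Suc)
      then show ?thesis
        by (simp add: algebra_simps)
    qed
    finally show ?thesis .
  qed
  moreover have "1 - qpoly dvd of_nat n - q_int qpoly n"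
  proof -
    have "of_nat n - q_int qpoly n = (\<Sum>i<n. 1 - qpoly ^ i)"
      by (simp add: q_int_def sum_subtractf)
    then show ?thesis
      by (metis dvd_sum q_int_mult dvdI)
  qed
  ultimately have "c dvd (of_nat n - q_int qpoly n) + q_int qpoly n"
    using c(1) by (meson dvd_add dvd_trans)
  then show "is_unit c"
    using q_int_unit_divisor[OF c(1), of "int n"] \<open>n > 0\<close> by (simp add: of_nat_poly)
qed

text \<open>Modulo a common divisor \<open>q^n\<close> is \<open>1\<close> and \<open>q^i\<close> is
  \<open>-1\<close>; as \<open>n\<close> is odd, \<open>q^(n*i)\<close> is both \<open>1\<close> and
  \<open>-1\<close>, so the divisor divides \<open>2\<close>.\<close>

lemma coprime_q_int_one_plus:
  assumes "odd n"
  shows "coprime (q_int qpoly n) (1 + qpoly ^ i)"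
proof (rule coprimeI)
  fix c assume c: "c dvd q_int qpoly n" "c dvd 1 + qpoly ^ i"
  have "1 - qpoly ^ n dvd 1 - (qpoly ^ n) ^ i"
    by (metis q_int_mult dvdI)
  then have "c dvd 1 - (qpoly ^ n) ^ i"
    using c(1) by (metis q_int_mult dvd_mult dvd_trans)
  moreover have "1 + qpoly ^ i dvd 1 + (qpoly ^ i) ^ n"
    using q_int_mult[of "- (qpoly ^ i)" n] assms by (simp add: dvdI) (metis dvdI)
  then have "c dvd 1 + (qpoly ^ i) ^ n"
    using c(2) by (rule dvd_trans[rotated])
  ultimately have "c dvd (1 - (qpoly ^ n) ^ i) + (1 + (qpoly ^ i) ^ n)"
    by (rule dvd_add)
  also have "\<dots> = [:2:]"
    by (simp add: mult.commute flip: power_mult) (simp add: numeral_poly)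
  finally show "is_unit c"
    using q_int_unit_divisor[OF c(1)] assms by (simp add: odd_pos)
qed

lemma coprime_q_int_q_poch:
  assumes "odd n"
  shows "coprime (q_int qpoly n) (q_poch (- (qpoly ^ r)) (qpoly ^ r) k)"
  unfolding q_poch_def
  by (intro prod_coprime_right)
    (use coprime_q_int_one_plus[OF assms] in \<open>simp flip: power_mult power_add\<close>)

section \<open>Passage between polynomials and rational functions\<close>

lemma to_fract_power [simp]: "to_fract (x ^ k) = to_fract x ^ k"
  by (induction k) simp_all

lemma to_fract_q_poch: "to_fract (q_poch x p k) = q_poch (to_fract x) (to_fract p) k"
  by (induction k) (simp_all add: q_poch_Suc)

text \<open>The fraction \<open>N / D\<close> need not be reduced: if \<open>a / b\<close> is the
  reduced form, then \<open>D * a = N * b\<close>, so \<open>P\<close> divides \<open>D * a\<close>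
  and hence \<open>a\<close>.\<close>

lemma q_cong_0I:
  assumes "to_fract D * S = to_fract N" and "P dvd N" and "coprime P D"
  shows "q_cong S 0 P"
proof -
  obtain a b where ab: "quot_of_fract S = (a, b)"
    by force
  have "b \<noteq> 0" "S = to_fract a / to_fract b"
    using ab snd_quot_of_fract_nonzero[of S] quot_to_fract_quot_of_fract[of S]
    by (auto simp: quot_to_fract_def Fract_conv_to_fract)
  then have "to_fract (D * a) = to_fract (N * b)"
    using assms(1) by (simp add: field_simps) (metis mult.assoc mult.commute)
  then have "P dvd D * a"
    using assms(2) by (simp only: to_fract_eq_iff dvd_mult2)
  then show ?thesis
    using assms(3) by (simp add: q_cong_def ab coprime_dvd_mult_right_iff)
qed

lemma qpoly_power_neq_1: "i > 0 \<Longrightarrow> qpoly ^ i \<noteq> 1"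
  using degree_power_eq[of qpoly i] by (auto simp: qpoly_def)

text \<open>Rewrites \<open>sum_num / sum_den\<close> as \<open>N / D\<close> in cross-multiplied
  form, as needed for \<open>q_cong_0I\<close>.\<close>

lemma sum_num_dvd:
  fixes q :: "int poly"
  defines "q \<equiv> qpoly"
  assumes "coprime n 6" and "n > 0" and "M = n - 1 \<or> M = (n - 1) div 2"
  shows "\<exists>D N. sum_num q M * D = sum_den q M * N \<and> q_int q n ^ 2 dvd N \<and> coprime (q_int q n ^ 2) D"
proof -
  have "coprime n 2" "coprime n 3"
    by (rule coprime_divisors[OF dvd_refl _ assms(2)]; simp)+
  then have "odd n"
    by simp
  have q1: "q ^ i \<noteq> 1" if "i > 0" for i
    using that qpoly_power_neq_1 by (simp add: q_def)
  define U where "U r k = q_poch (- (q ^ r)) (q ^ r) k" for r k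
  define Od where "Od r k = q_poch (q ^ r) (q ^ (2 * r)) k" for r k
  define E where "E r k = q_poch (q ^ (2 * r)) (q ^ (2 * r)) k" for r k
  have "\<exists>B. Od r k * U r k ^ 2 = E r k * B" if "r > 0" for r k
    using central_q_binomial_dvd[of "q ^ r" k] q_poch_nonzero[OF q1, of "2 * r" "2 * r" k] that
    by (auto simp: Od_def U_def E_def mult.commute dvd_def simp flip: power_mult)
  \<comment> \<open>\<open>B r k\<close> is the central \<open>q\<close>-binomial coefficient in
    base \<open>q^r\<close>; only \<open>r = 1\<close> and \<open>r = 3\<close> are used.\<close>
  then obtain B where B: "Od r k * U r k ^ 2 = E r k * B r k" if "r > 0" for r k
    by metis
  have cop: "coprime (q_int q n) (1 - q ^ i)" if "coprime i n" for i
    using coprime_q_int_one_minus[OF that \<open>n > 0\<close>] by (simp add: q_def)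
  have copU: "coprime (q_int q n) (U r k)" for r k
    using coprime_q_int_q_poch[OF \<open>odd n\<close>] by (simp add: U_def q_def)
  have dvd: "q_int q n dvd 1 - q ^ (n * i)" for i
    using q_int_mult[of q n] q_int_mult[of "q ^ n" i] by (metis dvd_mult dvd_mult2 dvd_refl power_mult)
  define c where "c = (1 - q)^2 * (1 - q^3)"
  have copc: "coprime (q_int q n) c"
    using cop[of 1] cop[of 3] \<open>coprime n 3\<close> by (simp add: c_def coprime_commute)
  \<comment> \<open>Prefixing the two missing factors turns \<open>(q^6; q^2)_k\<close> into an even
    factorial.\<close>
  have G: "q_poch (q^6) (q^2) k * ((1 - q^2) * (1 - q^4)) = E 1 (k + 2)" for k
  proof -
    have "q_poch (q^2) (q^2) 2 = (1 - q^2) * (1 - q^4)"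
      by (simp add: q_poch_Suc eval_nat_numeral)
    moreover have "q^2 * (q^2)^2 = q^6"
      by (simp flip: power_mult power_add)
    ultimately show ?thesis
      using q_poch_add[of "q^2" "q^2" 2 k]
      by (simp only: E_def mult_1_right) (simp add: add.commute mult.commute)
  qed
  show ?thesis
    using assms(4)
  proof
    assume M: "M = n - 1"
    with \<open>n > 0\<close> have n: "n = M + 1"
      by simp
    \<comment> \<open>These factors adjust all factorials to the paired lengths \<open>n\<close>,
      \<open>2 * n\<close> (base \<open>q\<close>) and \<open>n\<close> (base \<open>q^3\<close>).
      The last factor of \<open>v\<close>, and \<open>w\<close>, are the ones divisible by
      \<open>[n]\<close>.\<close>
    define s t v w z where "s = 1 - q ^ (2 * n + 2)" and "t = 1 - q ^ (6 * M + 3)"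
      and "v = (1 - q ^ (4 * M + 2)) * (1 - q ^ (n * 4))" and "w = 1 - q ^ (n * 6)"
      and "z = (1 - q^2) * (1 - q^4)"
    define D where "D = c * s * t * (U 1 n ^ 2 * U 1 (2 * n) ^ 2 * U 3 n ^ 2)"
    define N where "N = B 1 n * B 1 (2 * n) * B 3 n * (v * w) * z"
    have P: "Od 3 M * t = Od 3 n" "E 1 (2 * M) * v = E 1 (2 * n)" "E 3 M * w = E 3 n"
      "q_poch (q^6) (q^2) M * z = E 1 n * s"
      using G[of M]
      by (simp_all add: n Od_def E_def t_def v_def w_def z_def s_def q_poch_Suc mult_ac
          flip: power_mult power_add power_Suc)
        (auto simp: eval_nat_numeral add_ac)
    have "sum_den q M * N = c * (E 1 (2 * M) * v * B 1 (2 * n)) * (E 3 M * w * B 3 n)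
        * (q_poch (q^6) (q^2) M * z * B 1 n)"
      by (simp add: sum_den_def N_def c_def E_def mult_ac)
    also have "\<dots> = c * (E 1 (2 * n) * B 1 (2 * n)) * (E 3 n * B 3 n) * (E 1 n * B 1 n) * s"
      unfolding P by (simp only: mult_ac)
    also have "\<dots> = c * (Od 1 (2 * n) * U 1 (2 * n) ^ 2) * (Od 3 M * t * U 3 n ^ 2)
        * (Od 1 n * U 1 n ^ 2) * s"
      unfolding P by (simp add: B)
    also have "\<dots> = sum_num q M * D"
      by (simp add: sum_num_def D_def n Od_def mult_ac)
    finally have eq: "sum_num q M * D = sum_den q M * N" ..
    have "q_int q n ^ 2 dvd v * w"
      using dvd unfolding power2_eq_square v_def w_def by (intro mult_dvd_mono dvd_mult)
    then have N: "q_int q n ^ 2 dvd N"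
      by (simp add: N_def)
    have "coprime (2 * n + 2) n"
      using \<open>coprime n 2\<close> coprime_mult_left_iff[of 2 "n + 1" n]
      by (simp add: coprime_commute)
    \<comment> \<open>As \<open>6 * M + 3 = 6 * n - 3\<close>, a common divisor divides
      \<open>3\<close>.\<close>
    moreover have "coprime (6 * M + 3) n"
    proof (rule coprimeI)
      fix d assume d: "d dvd 6 * M + 3" "d dvd n"
      then have "d dvd 6 * n - (6 * M + 3)"
        by (intro dvd_diff_nat dvd_mult)
      then have "d dvd 3"
        by (simp add: n)
      then show "is_unit d"
        using d \<open>coprime n 3\<close> by (meson coprime_common_divisor)
    qed
    ultimately have "coprime (q_int q n) s" "coprime (q_int q n) t"
      by (simp_all only: s_def t_def cop)
    then have "coprime (q_int q n ^ 2) D"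
      using copc copU by (simp add: D_def)
    with eq N show ?thesis
      by blast
  next
    assume M: "M = (n - 1) div 2"
    with \<open>odd n\<close> have n: "n = 2 * M + 1"
      by (auto elim: oddE)
    \<comment> \<open>Now the paired lengths are \<open>M\<close>, \<open>n\<close> and
      \<open>M\<close>. \<open>w\<close> is the last factor of \<open>(q; q^2)_{M+1}\<close>, and
      \<open>v\<close> extends \<open>(q^2; q^2)_{2M}\<close> to length \<open>n\<close>; both are
      divisible by \<open>[n]\<close>.\<close>
    define s t v w z where "s = (1 - q ^ (n + 1)) * (1 - q ^ (n + 3))" and "t = 1 - q ^ (2 * n + 1)"
      and "v = 1 - q ^ (n * 2)" and "w = 1 - q ^ (n * 1)" and "z = (1 - q^2) * (1 - q^4)"
    define D where "D = c * s * (U 1 M ^ 2 * U 1 n ^ 2 * U 3 M ^ 2)"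
    define N where "N = B 1 M * B 1 n * B 3 M * (v * w) * t * z"
    have P: "Od 1 (M + 1) = Od 1 M * w" "Od 1 (2 * M + 2) = Od 1 n * t" "E 1 (2 * M) * v = E 1 n"
      "q_poch (q^6) (q^2) M * z = E 1 M * s"
      using G[of M]
      by (simp_all add: n Od_def E_def t_def v_def w_def z_def s_def q_poch_Suc mult_ac
          flip: power_mult power_add power_Suc)
        (auto simp: eval_nat_numeral add_ac)
    have "sum_den q M * N = c * (E 1 (2 * M) * v * B 1 n) * (E 3 M * B 3 M)
        * (q_poch (q^6) (q^2) M * z * B 1 M) * (w * t)"
      by (simp add: sum_den_def N_def c_def E_def mult_ac)
    also have "\<dots> = c * (E 1 n * B 1 n) * (E 3 M * B 3 M) * (E 1 M * B 1 M) * (s * w * t)"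
      unfolding P by (simp only: mult_ac)
    also have "\<dots> = c * (Od 1 n * U 1 n ^ 2) * (Od 3 M * U 3 M ^ 2) * (Od 1 M * U 1 M ^ 2) * (s * w * t)"
      by (simp add: B)
    also have "\<dots> = Od 1 (M + 1) * Od 1 (2 * M + 2) * Od 3 M * D"
      unfolding P by (simp only: D_def mult_ac)
    also have "\<dots> = sum_num q M * D"
      by (simp add: sum_num_def Od_def)
    finally have eq: "sum_num q M * D = sum_den q M * N" ..
    have "q_int q n ^ 2 dvd v * w"
      using dvd unfolding power2_eq_square v_def w_def by (intro mult_dvd_mono)
    then have N: "q_int q n ^ 2 dvd N"
      by (simp add: N_def)
    have "coprime (n + 1) n"
      by simp
    moreover have "coprime (n + 3) n"
      using \<open>coprime n 3\<close> gcd_add1[of 3 n]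
      by (simp add: coprime_iff_gcd_eq_1 gcd.commute add.commute)
    ultimately have "coprime (q_int q n) s"
      by (simp only: s_def cop coprime_mult_right_iff)
    then have "coprime (q_int q n ^ 2) D"
      using copc copU by (simp add: D_def)
    with eq N show ?thesis
      by blast
  qed
qed

theorem theorem7p4:
  fixes n M :: nat
  assumes "n > 0" and "coprime n 6" and "M = n - 1 \<or> M = (n - 1) div 2"
  shows "q_cong
    (\<Sum>k=0..M. q_int qrat (8 * k + 1) *
       ((q_poch qrat (qrat ^ 2) k) ^ 2 * q_poch qrat (qrat ^ 2) (2 * k) *
          q_poch (qrat powi (-3)) (qrat ^ 6) k /
        (q_poch (qrat ^ 2) (qrat ^ 2) (2 * k) * q_poch (qrat ^ 6) (qrat ^ 6) k *
          (q_poch (qrat powi (-3)) (qrat ^ 2) k * q_poch (qrat ^ 6) (qrat ^ 2) k))) *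
       qrat ^ (2 * k))
    0 ((q_int qpoly n) ^ 2)"
proof -
  obtain D N where DN: "sum_num qpoly M * D = sum_den qpoly M * N"
    "q_int qpoly n ^ 2 dvd N" "coprime (q_int qpoly n ^ 2) D"
    using sum_num_dvd[OF assms(2,1,3)] by blast
  have q0: "qrat \<noteq> 0"
    by (simp add: qrat_def qpoly_def)
  have q1: "qrat ^ i \<noteq> 1" if "i > 0" for i
    using qpoly_power_neq_1[OF that] by (metis qrat_def to_fract_power to_fract_eq_iff to_fract_1)
  have num: "to_fract (sum_num qpoly M) = sum_num qrat M"
    and den: "to_fract (sum_den qpoly M) = sum_den qrat M"
    by (simp_all add: sum_num_def sum_den_def qrat_def to_fract_q_poch)
  have "sum_num qrat M * to_fract D = sum_den qrat M * to_fract N"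
    using arg_cong[OF DN(1), of to_fract] by (simp add: num den)
  then have "to_fract D * (sum_num qrat M / sum_den qrat M) = to_fract N"
    using sum_den_nonzero[OF q1, of M] by (simp add: field_simps)
  then show ?thesis
    using q_cong_0I DN(2,3) by (simp only: sum_closed_form[OF q0 q1])
qed

end
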